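(* Let $D_1\in\mathbb{R}^{n\times m_1}$ and $D_i\in\mathbb{R}^{m_{i-1}\times m_i}$ ($2\le i\le k$), and let $x=D_1\gamma_1$, $\gamma_{i-1}=D_i\gamma_i$ ($2\le i\le k$), where $\gamma_i\in\mathbb{R}^{m_i}$ has support $\Lambda_i$ of cardinality $s_i$. Let $y=x+e$ with $e\sim\mathcal{N}(0,\sigma^2 I)$. Assume the RIP constant of $D_{(k)}=D_1D_2\cdots D_k$ satisfies $\delta_{s_k}^{D_{(k)}}<1$. Let $\hat\gamma_1,\dots,\hat\gamma_k$ be the projection oracle estimators. Then for every $1\le i\le k-1$, $$ \sigma^2 s_k\,\frac{\prod_{j=i+1}^{k}\left(\frac{s_{j-1}}{m_{j-1}}-\delta_{s_{j-1},s_j}^{D_j}\right)}{1+\delta_{s_k}^{D_{(k)}}} \;\le\;\mathbb{E}\,\|\gamma_i-\hat\gamma_i\|_2^2\;\le\; \sigma^2 s_k\,\frac{\prod_{j=i+1}^{k}\left(\frac{s_{j-1}}{m_{j-1}}+\delta_{s_{j-1},s_j}^{D_j}\right)}{1-\delta_{s_k}^{D_{(k)}}}. $$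
   Context: Notation. For a vector $v$ and index set $\Lambda$, $v^{\Lambda}$ is the restriction of $v$ to $\Lambda$. For a matrix $D$, $D^{\Lambda_c}$ is the submatrix of columns indexed by $\Lambda_c$, and $D^{\Lambda_r,\Lambda_c}$ is the submatrix with rows $\Lambda_r$ and columns $\Lambda_c$. $A^\dagger$ is the Moore–Penrose pseudo-inverse. RIP constant: $\delta_s^D$ is the smallest $\delta\ge 0$ such that $(1-\delta)\|v\|_2^2\le\|D^{\Lambda}v\|_2^2\le(1+\delta)\|v\|_2^2$ for every set $\Lambda$ of $s$ columns and every $v\in\mathbb{R}^s$. Subset RIP constant: for $D\in\mathbb{R}^{n\times m}$, $\delta_{s_R,s_C}^D$ is the minimum constant such that for every subset $\Lambda_R$ of $s_R$ rows, every subset $\Lambda_C$ of $s_C$ columns and all vectors $v\in\mathbb{R}^{s_C}$, $$\left(\tfrac{s_R}{n}-\delta_{s_R,s_C}^D\right)\|v\|_2^2\le\|D^{\Lambda_R,\Lambda_C}v\|_2^2\le\left(\tfrac{s_R}{n}+\delta_{s_R,s_C}^D\right)\|v\|_2^2 .$$ Projection oracle estimators (the true supports $\Lambda_1,\dots,\Lambda_k$ are known): each $\hat\gamma_i\in\mathbb{R}^{m_i}$ vanishes outside $\Lambda_i$, with $$\hat\gamma_k^{\Lambda_k}=\left(D_{(k)}^{\Lambda_k}\right)^{\dagger}y,\qquad \hat\gamma_i^{\Lambda_i}=D_{i+1}^{\Lambda_i,\Lambda_{i+1}}\hat\gamma_{i+1}^{\Lambda_{i+1}}\quad (i=k-1,\dots,1).$$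 The expectation is over the noise $e$; $x$ and the $\gamma_i$ are fixed.
   Formalization: The lower bound is claimed only if all factors s_{j-1}/m_{j-1} − δ_{s_{j-1},s_j}^{D_j} (i+1≤j≤k) are nonnegative or their product is ≤ 0; it can fail when an even number of factors are negative and the product is positive. The upper bound is unchanged. *)

theory Defs
  imports
    "HOL-Probability.Probability"
    "Jordan_Normal_Form.DL_Submatrix"
begin

hide_type (open) Finite_Cartesian_Product.vec
hide_const (open) Finite_Cartesian_Product.vec Finite_Cartesian_Product.mat
  Finite_Cartesian_Product.row Determinants.det
no_notation Finite_Cartesian_Product.vec_nth (infixl \<open>$\<close> 90)

text \<open>Dimensions vary with the layer, so matrices and vectors are those of
  \<^theory>\<open>Jordan_Normal_Form.Matrix\<close>; all indices start at 0.\<close>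

definition l2_norm :: "real vec \<Rightarrow> real" where
  "l2_norm v = sqrt (\<Sum>l<dim_vec v. (v $ l)\<^sup>2)"

definition vec_support :: "real vec \<Rightarrow> nat set" where
  "vec_support v = {l. l < dim_vec v \<and> v $ l \<noteq> 0}"

text \<open>The vector analogue of \<^const>\<open>submatrix\<close>; \<open>pick I l\<close> is the \<open>l\<close>-th smallest element of \<open>I\<close>.\<close>

definition subvector :: "'a vec \<Rightarrow> nat set \<Rightarrow> 'a vec" where
  "subvector v I = vec (card {l. l < dim_vec v \<and> l \<in> I}) (\<lambda>l. v $ (pick I l))"

text \<open>The defining set is a closed subset of the nonnegative reals and is nonempty,
  so the infimum is a minimum.\<close>

definition rip_const :: "nat \<Rightarrow> real mat \<Rightarrow> real" where
  "rip_const s D = Inf {\<delta>. 0 \<le> \<delta> \<and>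
     (\<forall>\<Lambda> v. \<Lambda> \<subseteq> {..<dim_col D} \<longrightarrow> card \<Lambda> = s \<longrightarrow> v \<in> carrier_vec s \<longrightarrow>
        (1 - \<delta>) * (l2_norm v)\<^sup>2 \<le> (l2_norm (submatrix D UNIV \<Lambda> *\<^sub>v v))\<^sup>2 \<and>
        (l2_norm (submatrix D UNIV \<Lambda> *\<^sub>v v))\<^sup>2 \<le> (1 + \<delta>) * (l2_norm v)\<^sup>2)}"

text \<open>As soon as some vector \<open>v \<noteq> 0\<close> is tested, the two inequalities already force \<open>0 \<le> \<delta>\<close>.
  The explicit constraint only matters when nothing is tested (e.g. \<open>sC = 0\<close>): without it,
  every real would be admissible and no minimum would exist.\<close>

definition subset_rip_const :: "nat \<Rightarrow> nat \<Rightarrow> real mat \<Rightarrow> real" where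
  "subset_rip_const sR sC D = Inf {\<delta>. 0 \<le> \<delta> \<and>
     (\<forall>\<Lambda>R \<Lambda>C v. \<Lambda>R \<subseteq> {..<dim_row D} \<longrightarrow> card \<Lambda>R = sR \<longrightarrow>
        \<Lambda>C \<subseteq> {..<dim_col D} \<longrightarrow> card \<Lambda>C = sC \<longrightarrow> v \<in> carrier_vec sC \<longrightarrow>
        (real sR / real (dim_row D) - \<delta>) * (l2_norm v)\<^sup>2
          \<le> (l2_norm (submatrix D \<Lambda>R \<Lambda>C *\<^sub>v v))\<^sup>2 \<and>
        (l2_norm (submatrix D \<Lambda>R \<Lambda>C *\<^sub>v v))\<^sup>2
          \<le> (real sR / real (dim_row D) + \<delta>) * (l2_norm v)\<^sup>2)}"

definition is_pseudo_inverse :: "real mat \<Rightarrow> real mat \<Rightarrow> bool" where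
  "is_pseudo_inverse A X \<longleftrightarrow> X \<in> carrier_mat (dim_col A) (dim_row A) \<and>
     A * X * A = A \<and> X * A * X = X \<and>
     transpose_mat (A * X) = A * X \<and> transpose_mat (X * A) = X * A"

definition pseudo_inverse :: "real mat \<Rightarrow> real mat" where
  "pseudo_inverse A = (THE X. is_pseudo_inverse A X)"

text \<open>\<open>dict_prod D k\<close> is \<open>D 1 * D 2 * \<dots> * D k\<close>.\<close>

primrec dict_prod :: "(nat \<Rightarrow> real mat) \<Rightarrow> nat \<Rightarrow> real mat" where
  "dict_prod D 0 = 1\<^sub>m (dim_row (D 1))"
| "dict_prod D (Suc j) = dict_prod D j * D (Suc j)"

definition projection_oracle ::
  "nat \<Rightarrow> (nat \<Rightarrow> nat) \<Rightarrow> (nat \<Rightarrow> real mat) \<Rightarrow> (nat \<Rightarrow> nat set) \<Rightarrow> real vec \<Rightarrow> (nat \<Rightarrow> real vec) \<Rightarrow> bool"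
  where
  "projection_oracle k m D \<Lambda> y \<gamma>h \<longleftrightarrow>
     (\<forall>i\<in>{1..k}. \<gamma>h i \<in> carrier_vec (m i) \<and> vec_support (\<gamma>h i) \<subseteq> \<Lambda> i) \<and>
     subvector (\<gamma>h k) (\<Lambda> k) = pseudo_inverse (submatrix (dict_prod D k) UNIV (\<Lambda> k)) *\<^sub>v y \<and>
     (\<forall>i\<in>{1..<k}. subvector (\<gamma>h i) (\<Lambda> i)
        = submatrix (D (i + 1)) (\<Lambda> i) (\<Lambda> (i + 1)) *\<^sub>v subvector (\<gamma>h (i + 1)) (\<Lambda> (i + 1)))"

text \<open>The random vector \<open>e\<close> on \<open>M\<close> has law \<open>N(0, \<sigma>\<^sup>2 I)\<close> on \<open>n\<close>-space: independent components,
  each \<open>N(0, \<sigma>\<^sup>2)\<close>. For \<open>\<sigma> = 0\<close> this is the point mass at 0, which has no density.\<close>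

definition (in prob_space) white_gaussian :: "nat \<Rightarrow> real \<Rightarrow> ('a \<Rightarrow> real vec) \<Rightarrow> bool" where
  "white_gaussian n \<sigma> e \<longleftrightarrow>
     (\<forall>\<omega>\<in>space M. e \<omega> \<in> carrier_vec n) \<and>
     indep_vars (\<lambda>_. borel) (\<lambda>l \<omega>. e \<omega> $ l) {..<n} \<and>
     (\<forall>l<n. if \<sigma> = 0 then AE \<omega> in M. e \<omega> $ l = 0
            else distributed M lborel (\<lambda>\<omega>. e \<omega> $ l) (normal_density 0 \<sigma>))"

end

theory Submission
  imports Defs "Jordan_Normal_Form.Determinant"
begin

text \<open>Let \<open>A\<close> consist of the columns of the effective dictionary in the deepest support and let
  \<open>X\<close> be its pseudo-inverse. The RIP makes the columns of \<open>A\<close> independent, so \<open>X A = 1\<close> and the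
  error of the deepest estimator is \<open>X e\<close>, with mean square \<open>\<sigma>\<^sup>2\<close> times the sum of the squared
  row norms of \<open>X\<close>. Each squared row norm lies between \<open>1 / (1 + \<delta>)\<close> and \<open>1 / (1 - \<delta>)\<close>:
  a row has inner product 1 with the matching column of \<open>A\<close>, and it lies in the column space of \<open>A\<close>.
  The error of layer \<open>j - 1\<close> is the restricted matrix of layer \<open>j\<close> applied to the error of layer
  \<open>j\<close>, so the subset RIP compares squared error norms of consecutive layers already for every
  realisation of the noise, and only the deepest layer requires an expectation.\<close>

section \<open>Euclidean norms and crude operator bounds\<close>

lemma l2_norm_sq: "(l2_norm v)\<^sup>2 = (\<Sum>l<dim_vec v. (v $ l)\<^sup>2)"
  unfolding l2_norm_def by (simp add: sum_nonneg)

lemma l2_norm_sq_scalar_prod: "(l2_norm v)\<^sup>2 = scalar_prod v v"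
  unfolding l2_norm_sq scalar_prod_def by (simp add: power2_eq_square lessThan_atLeast0)

lemma mult_mat_vec_index:
  assumes "i < dim_row A" "dim_vec v = dim_col A"
  shows "(A *\<^sub>v v) $ i = (\<Sum>l<dim_col A. A $$ (i, l) * v $ l)"
  using assms by (auto simp: scalar_prod_def lessThan_atLeast0 intro!: sum.cong)

lemma scalar_prod_Cauchy_real:
  fixes v w :: "real vec"
  assumes "dim_vec v = dim_vec w"
  shows "(scalar_prod v w)\<^sup>2 \<le> scalar_prod v v * scalar_prod w w"
  using Cauchy_Schwarz_ineq_sum[of "\<lambda>l. v $ l" "\<lambda>l. w $ l" "{0..<dim_vec w}"] assms
  by (simp add: scalar_prod_def power2_eq_square)

lemma scalar_prod_self_nonneg: "0 \<le> scalar_prod v (v :: real vec)"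
  by (simp add: scalar_prod_def sum_nonneg)

text \<open>Cauchy-Schwarz in each row, then summation over the rows. The constant is crude, but any
  finite one suffices to make the sets of admissible RIP constants nonempty.\<close>

lemma l2_norm_mult_mat_vec_le:
  fixes A :: "real mat"
  assumes v: "dim_vec v = dim_col A"
    and B: "\<And>i j. i < dim_row A \<Longrightarrow> j < dim_col A \<Longrightarrow> \<bar>A $$ (i, j)\<bar> \<le> B"
  shows "(l2_norm (A *\<^sub>v v))\<^sup>2 \<le> real (dim_row A) * real (dim_col A) * B\<^sup>2 * (l2_norm v)\<^sup>2"
proof -
  have "((A *\<^sub>v v) $ i)\<^sup>2 \<le> real (dim_col A) * B\<^sup>2 * (l2_norm v)\<^sup>2" if i: "i < dim_row A" for i
  proof -
    have "((A *\<^sub>v v) $ i)\<^sup>2 \<le> (\<Sum>l<dim_col A. (A $$ (i, l))\<^sup>2) * (l2_norm v)\<^sup>2"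
      unfolding mult_mat_vec_index[OF i v] l2_norm_sq v by (rule Cauchy_Schwarz_ineq_sum)
    also have "(\<Sum>l<dim_col A. (A $$ (i, l))\<^sup>2) \<le> (\<Sum>l<dim_col A. B\<^sup>2)"
    proof (rule sum_mono)
      fix l assume "l \<in> {..<dim_col A}"
      then show "(A $$ (i, l))\<^sup>2 \<le> B\<^sup>2"
        using power_mono[OF B[OF i, of l], of 2] by simp
    qed
    finally show ?thesis by (simp add: mult_right_mono)
  qed
  then have "(\<Sum>i<dim_row A. ((A *\<^sub>v v) $ i)\<^sup>2)
      \<le> (\<Sum>i<dim_row A. real (dim_col A) * B\<^sup>2 * (l2_norm v)\<^sup>2)"
    by (intro sum_mono) simp
  then show ?thesis by (simp add: l2_norm_sq[of "A *\<^sub>v v"] mult_ac)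
qed

lemma mat_entries_bounded:
  fixes A :: "real mat"
  obtains B where "\<And>i j. i < dim_row A \<Longrightarrow> j < dim_col A \<Longrightarrow> \<bar>A $$ (i, j)\<bar> \<le> B"
proof
  fix i j assume "i < dim_row A" "j < dim_col A"
  \<comment> \<open>For a matrix without entries this is \<open>Max {}\<close>, an unspecified real,
    but then no indices satisfy the premises.\<close>
  then show "\<bar>A $$ (i, j)\<bar> \<le> Max ((\<lambda>(i, j). \<bar>A $$ (i, j)\<bar>) ` ({..<dim_row A} \<times> {..<dim_col A}))"
    by (intro Max_ge) force+
qed

section \<open>Restriction to index sets\<close>

lemma card_less_Int: "I \<subseteq> {..<n} \<Longrightarrow> card {i. i < n \<and> i \<in> I} = card I"
  by (rule arg_cong[of _ _ card]) auto

lemma submatrix_carrier: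
  assumes "A \<in> carrier_mat nr nc" "I \<subseteq> {..<nr}" "J \<subseteq> {..<nc}"
  shows "submatrix A I J \<in> carrier_mat (card I) (card J)"
  using assms by (intro carrier_matI) (simp_all add: dim_submatrix card_less_Int)

lemma subvector_carrier:
  assumes "v \<in> carrier_vec n" "I \<subseteq> {..<n}"
  shows "subvector v I \<in> carrier_vec (card I)"
  using assms by (intro carrier_vecI) (simp add: subvector_def card_less_Int)

lemma subvector_index:
  assumes "v \<in> carrier_vec n" "I \<subseteq> {..<n}" "l < card I"
  shows "subvector v I $ l = v $ pick I l"
  using assms by (simp add: subvector_def card_less_Int)

text \<open>\<open>pick I\<close> is strictly increasing below \<open>card I\<close>, hence
  injective there; its image is a subset of the finite set \<open>I\<close> with
  \<open>card I\<close> elements, so it is all of \<open>I\<close>. Sums over positions thus become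
  sums over indices.\<close>

lemma bij_betw_pick:
  assumes "finite I"
  shows "bij_betw (pick I) {..<card I} I"
proof -
  have inj: "inj_on (pick I) {..<card I}"
    by (rule linorder_inj_onI) (auto dest: pick_mono_le)
  have "pick I ` {..<card I} \<subseteq> I" by (auto intro: pick_in_set_le)
  moreover have "card (pick I ` {..<card I}) = card I" using inj by (simp add: card_image)
  ultimately have "pick I ` {..<card I} = I" using assms by (intro card_subset_eq) auto
  with inj show ?thesis by (simp add: bij_betw_def)
qed

lemma sum_pick:
  assumes "finite I"
  shows "(\<Sum>l<card I. f (pick I l)) = sum f I"
  using sum.reindex_bij_betw[OF bij_betw_pick[OF assms]] .

lemma l2_norm_subvector:
  assumes v: "v \<in> carrier_vec n" and I: "I \<subseteq> {..<n}" and supp: "vec_support v \<subseteq> I"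
  shows "l2_norm (subvector v I) = l2_norm v"
proof -
  have fin: "finite I" using I finite_subset by blast
  have "(\<Sum>l<card I. (subvector v I $ l)\<^sup>2) = (\<Sum>l<card I. (v $ pick I l)\<^sup>2)"
    using subvector_index[OF v I] by simp
  also have "\<dots> = (\<Sum>l\<in>I. (v $ l)\<^sup>2)" using sum_pick[OF fin] .
  also have "\<dots> = (\<Sum>l<n. (v $ l)\<^sup>2)"
    using I supp v by (intro sum.mono_neutral_left) (auto simp: vec_support_def)
  finally show ?thesis
    using v subvector_carrier[OF v I] by (simp add: l2_norm_def)
qed

text \<open>The columns outside \<open>J\<close> only meet zero entries of \<open>v\<close>, so
  dropping both leaves the product unchanged. This carries the relations between consecutive
  \<open>\<gamma> i\<close> over to the supports.\<close>

lemma submatrix_mult_subvector: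
  fixes A :: "real mat"
  assumes A: "A \<in> carrier_mat nr nc" and I: "I \<subseteq> {..<nr}" and J: "J \<subseteq> {..<nc}"
    and v: "v \<in> carrier_vec nc" and supp: "vec_support v \<subseteq> J"
  shows "submatrix A I J *\<^sub>v subvector v J = subvector (A *\<^sub>v v) I"
proof (rule eq_vecI)
  note SA = submatrix_carrier[OF A I J] and sv = subvector_carrier[OF v J]
  have Av: "A *\<^sub>v v \<in> carrier_vec nr" using A v by simp
  show "dim_vec (submatrix A I J *\<^sub>v subvector v J) = dim_vec (subvector (A *\<^sub>v v) I)"
    using SA subvector_carrier[OF Av I] by simp
  fix i assume "i < dim_vec (subvector (A *\<^sub>v v) I)"
  then have i: "i < card I" using subvector_carrier[OF Av I] by simp
  then have pI: "pick I i < nr" using I pick_in_set_le by blast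
  have "(submatrix A I J *\<^sub>v subvector v J) $ i
      = (\<Sum>l<card J. submatrix A I J $$ (i, l) * subvector v J $ l)"
    using SA sv i by (subst mult_mat_vec_index) auto
  also have "\<dots> = (\<Sum>l<card J. A $$ (pick I i, pick J l) * v $ pick J l)"
    using A i I J subvector_index[OF v J]
    by (intro sum.cong) (auto simp: submatrix_index card_less_Int)
  also have "\<dots> = (\<Sum>l\<in>J. A $$ (pick I i, l) * v $ l)"
    using J by (intro sum_pick[of J "\<lambda>l. A $$ (pick I i, l) * v $ l"]) (auto intro: finite_subset)
  also have "\<dots> = (\<Sum>l<nc. A $$ (pick I i, l) * v $ l)"
    using J supp v by (intro sum.mono_neutral_left) (auto simp: vec_support_def)
  also have "\<dots> = (A *\<^sub>v v) $ pick I i"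
    using A v pI by (subst mult_mat_vec_index) auto
  also have "\<dots> = subvector (A *\<^sub>v v) I $ i" using subvector_index[OF Av I i] by simp
  finally show "(submatrix A I J *\<^sub>v subvector v J) $ i = subvector (A *\<^sub>v v) I $ i" .
qed

lemma pick_lessThan:
  assumes "i < n"
  shows "pick {..<n} i = i"
proof -
  have "{a \<in> {..<n}. a < i} = {..<i}" using assms by auto
  then show ?thesis using pick_card_in_set[of i "{..<n}"] assms by simp
qed

text \<open>\<open>rip_const\<close> writes \<open>UNIV\<close> for an unrestricted row set, whereas
  the carrier and product lemmas for submatrices ask for a set of actual row indices.\<close>

lemma submatrix_UNIV_row:
  assumes "A \<in> carrier_mat nr nc"
  shows "submatrix A UNIV J = submatrix A {..<nr} J"
  using assms by (auto simp: submatrix_def pick_UNIV pick_lessThan intro!: cong_mat)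

lemma subvector_lessThan:
  assumes "v \<in> carrier_vec n"
  shows "subvector v {..<n} = v"
  using assms by (intro eq_vecI) (auto simp: subvector_def pick_lessThan)

lemma subvector_minus:
  fixes v w :: "real vec"
  assumes "v \<in> carrier_vec n" "w \<in> carrier_vec n" "I \<subseteq> {..<n}"
  shows "subvector (v - w) I = subvector v I - subvector w I"
proof (rule eq_vecI)
  have vw: "v - w \<in> carrier_vec n" using assms by simp
  note sub = subvector_carrier[OF assms(1,3)] subvector_carrier[OF assms(2,3)]
    subvector_carrier[OF vw assms(3)]
  then show "dim_vec (subvector (v - w) I) = dim_vec (subvector v I - subvector w I)" by simp
  fix l assume "l < dim_vec (subvector v I - subvector w I)"
  then have l: "l < card I" using sub by simp
  then have "pick I l < n" using assms(3) pick_in_set_le by blast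
  with l sub show "subvector (v - w) I $ l = (subvector v I - subvector w I) $ l"
    using assms by (simp add: subvector_index[OF _ assms(3) l])
qed

text \<open>Entries of a submatrix are entries of \<open>A\<close>, and its dimensions are at most
  those of \<open>A\<close>, so one constant serves all index sets at once.\<close>

lemma submatrix_mult_bounded:
  fixes A :: "real mat"
  obtains C where "0 \<le> C"
    "\<And>I J v. I \<subseteq> {..<dim_row A} \<Longrightarrow> J \<subseteq> {..<dim_col A} \<Longrightarrow> v \<in> carrier_vec (card J) \<Longrightarrow>
      (l2_norm (submatrix A I J *\<^sub>v v))\<^sup>2 \<le> C * (l2_norm v)\<^sup>2"
proof -
  obtain B where B: "\<And>i j. i < dim_row A \<Longrightarrow> j < dim_col A \<Longrightarrow> \<bar>A $$ (i, j)\<bar> \<le> B"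
    by (rule mat_entries_bounded[of A]) blast
  show thesis
  proof (rule that[of "real (dim_row A) * real (dim_col A) * B\<^sup>2"])
    fix I J and v :: "real vec"
    assume I: "I \<subseteq> {..<dim_row A}" and J: "J \<subseteq> {..<dim_col A}" and v: "v \<in> carrier_vec (card J)"
    have S: "submatrix A I J \<in> carrier_mat (card I) (card J)"
      using submatrix_carrier[OF carrier_matI[OF refl refl] I J] .
    have "(l2_norm (submatrix A I J *\<^sub>v v))\<^sup>2
        \<le> real (dim_row (submatrix A I J)) * real (dim_col (submatrix A I J)) * B\<^sup>2 * (l2_norm v)\<^sup>2"
    proof (rule l2_norm_mult_mat_vec_le)
      show "dim_vec v = dim_col (submatrix A I J)" using S v by simp
      fix i j assume ij: "i < dim_row (submatrix A I J)" "j < dim_col (submatrix A I J)"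
      then have "pick I i < dim_row A" "pick J j < dim_col A"
        using S I J pick_in_set_le[of i I] pick_in_set_le[of j J] by auto
      then show "\<bar>submatrix A I J $$ (i, j)\<bar> \<le> B"
        using ij B by (simp add: submatrix_index dim_submatrix)
    qed
    also have "\<dots> = real (card I) * real (card J) * B\<^sup>2 * (l2_norm v)\<^sup>2"
      using S by simp
    also have "\<dots> \<le> real (dim_row A) * real (dim_col A) * B\<^sup>2 * (l2_norm v)\<^sup>2"
      using card_mono[OF _ I] card_mono[OF _ J]
      by (intro mult_right_mono mult_mono) auto
    finally show "(l2_norm (submatrix A I J *\<^sub>v v))\<^sup>2
      \<le> real (dim_row A) * real (dim_col A) * B\<^sup>2 * (l2_norm v)\<^sup>2" .
  qed simp
qed

section \<open>The restricted isometry constants are attained\<close>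

text \<open>The admissible constants are bounded below by 0, nonempty by the uniform operator bound,
  and closed because they are cut out by non-strict inequalities continuous in \<delta>. The infimum
  is therefore admissible itself, and its inequalities become available.\<close>

lemma subset_rip_const_attained:
  "0 \<le> subset_rip_const sR sC D \<and>
     (\<forall>\<Lambda>R \<Lambda>C v. \<Lambda>R \<subseteq> {..<dim_row D} \<longrightarrow> card \<Lambda>R = sR \<longrightarrow>
        \<Lambda>C \<subseteq> {..<dim_col D} \<longrightarrow> card \<Lambda>C = sC \<longrightarrow> v \<in> carrier_vec sC \<longrightarrow>
        (real sR / real (dim_row D) - subset_rip_const sR sC D) * (l2_norm v)\<^sup>2
          \<le> (l2_norm (submatrix D \<Lambda>R \<Lambda>C *\<^sub>v v))\<^sup>2 \<and>
        (l2_norm (submatrix D \<Lambda>R \<Lambda>C *\<^sub>v v))\<^sup>2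
          \<le> (real sR / real (dim_row D) + subset_rip_const sR sC D) * (l2_norm v)\<^sup>2)"
proof -
  let ?S = "{\<delta>. 0 \<le> \<delta> \<and>
     (\<forall>\<Lambda>R \<Lambda>C v. \<Lambda>R \<subseteq> {..<dim_row D} \<longrightarrow> card \<Lambda>R = sR \<longrightarrow>
        \<Lambda>C \<subseteq> {..<dim_col D} \<longrightarrow> card \<Lambda>C = sC \<longrightarrow> v \<in> carrier_vec sC \<longrightarrow>
        (real sR / real (dim_row D) - \<delta>) * (l2_norm v)\<^sup>2
          \<le> (l2_norm (submatrix D \<Lambda>R \<Lambda>C *\<^sub>v v))\<^sup>2 \<and>
        (l2_norm (submatrix D \<Lambda>R \<Lambda>C *\<^sub>v v))\<^sup>2
          \<le> (real sR / real (dim_row D) + \<delta>) * (l2_norm v)\<^sup>2)}"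
  obtain C where C: "0 \<le> C"
    "\<And>I J v. I \<subseteq> {..<dim_row D} \<Longrightarrow> J \<subseteq> {..<dim_col D} \<Longrightarrow> v \<in> carrier_vec (card J) \<Longrightarrow>
      (l2_norm (submatrix D I J *\<^sub>v v))\<^sup>2 \<le> C * (l2_norm v)\<^sup>2"
    by (rule submatrix_mult_bounded[of D]) blast
  let ?q = "real sR / real (dim_row D)"
  \<comment> \<open>Adding \<open>?q\<close> to the operator bound makes the lower factor
    \<open>- C\<close>, so the lower inequality is trivial, while the upper factor stays at least
    \<open>C\<close>.\<close>
  have "?q + C \<in> ?S"
  proof (intro CollectI conjI allI impI)
    show "0 \<le> ?q + C" using C by simp
    fix \<Lambda>R \<Lambda>C and v :: "real vec"
    assume *: "\<Lambda>R \<subseteq> {..<dim_row D}" "card \<Lambda>R = sR" "\<Lambda>C \<subseteq> {..<dim_col D}" "card \<Lambda>C = sC"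
      "v \<in> carrier_vec sC"
    have "(?q - (?q + C)) * (l2_norm v)\<^sup>2 \<le> 0"
      using C by (simp add: mult_nonneg_nonneg)
    then show "(?q - (?q + C)) * (l2_norm v)\<^sup>2 \<le> (l2_norm (submatrix D \<Lambda>R \<Lambda>C *\<^sub>v v))\<^sup>2"
      by (rule order_trans) simp
    have "(l2_norm (submatrix D \<Lambda>R \<Lambda>C *\<^sub>v v))\<^sup>2 \<le> C * (l2_norm v)\<^sup>2"
      using C * by auto
    also have "\<dots> \<le> (?q + (?q + C)) * (l2_norm v)\<^sup>2"
      by (intro mult_right_mono) auto
    finally show "(l2_norm (submatrix D \<Lambda>R \<Lambda>C *\<^sub>v v))\<^sup>2 \<le> (?q + (?q + C)) * (l2_norm v)\<^sup>2" .
  qed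
  then have "?S \<noteq> {}" by blast
  moreover have "bdd_below ?S" by (rule bdd_belowI[of _ 0]) simp
  \<comment> \<open>The premises on index sets and vectors do not mention \<delta>, so each cuts out
    the whole line or nothing; such sets are open, as \<open>closed_Collect_imp\<close> requires of
    a premise.\<close>
  moreover have "closed ?S"
    by (intro closed_Collect_conj closed_Collect_all closed_Collect_imp closed_Collect_le
        open_Collect_const continuous_intros)
  ultimately have "Inf ?S \<in> ?S" by (rule closed_contains_Inf)
  then have "subset_rip_const sR sC D \<in> ?S" unfolding subset_rip_const_def .
  then show ?thesis unfolding mem_Collect_eq .
qed

text \<open>As for the subset constant, with the row fraction replaced by 1 and the witness
  \<open>1 + C\<close>.\<close>

lemma rip_const_attained:
  "0 \<le> rip_const s D \<and>
     (\<forall>\<Lambda> v. \<Lambda> \<subseteq> {..<dim_col D} \<longrightarrow> card \<Lambda> = s \<longrightarrow> v \<in> carrier_vec s \<longrightarrow>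
        (1 - rip_const s D) * (l2_norm v)\<^sup>2 \<le> (l2_norm (submatrix D UNIV \<Lambda> *\<^sub>v v))\<^sup>2 \<and>
        (l2_norm (submatrix D UNIV \<Lambda> *\<^sub>v v))\<^sup>2 \<le> (1 + rip_const s D) * (l2_norm v)\<^sup>2)"
proof -
  let ?S = "{\<delta>. 0 \<le> \<delta> \<and>
     (\<forall>\<Lambda> v. \<Lambda> \<subseteq> {..<dim_col D} \<longrightarrow> card \<Lambda> = s \<longrightarrow> v \<in> carrier_vec s \<longrightarrow>
        (1 - \<delta>) * (l2_norm v)\<^sup>2 \<le> (l2_norm (submatrix D UNIV \<Lambda> *\<^sub>v v))\<^sup>2 \<and>
        (l2_norm (submatrix D UNIV \<Lambda> *\<^sub>v v))\<^sup>2 \<le> (1 + \<delta>) * (l2_norm v)\<^sup>2)}"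
  obtain C where C: "0 \<le> C"
    "\<And>I J v. I \<subseteq> {..<dim_row D} \<Longrightarrow> J \<subseteq> {..<dim_col D} \<Longrightarrow> v \<in> carrier_vec (card J) \<Longrightarrow>
      (l2_norm (submatrix D I J *\<^sub>v v))\<^sup>2 \<le> C * (l2_norm v)\<^sup>2"
    by (rule submatrix_mult_bounded[of D]) blast
  have U: "submatrix D UNIV J = submatrix D {..<dim_row D} J" for J
    by (rule submatrix_UNIV_row[of _ _ "dim_col D"]) auto
  have "1 + C \<in> ?S"
  proof (intro CollectI conjI allI impI)
    show "0 \<le> 1 + C" using C by simp
    fix \<Lambda> and v :: "real vec"
    assume *: "\<Lambda> \<subseteq> {..<dim_col D}" "card \<Lambda> = s" "v \<in> carrier_vec s"
    have "(1 - (1 + C)) * (l2_norm v)\<^sup>2 \<le> 0"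
      using C by (simp add: mult_nonneg_nonneg)
    then show "(1 - (1 + C)) * (l2_norm v)\<^sup>2 \<le> (l2_norm (submatrix D UNIV \<Lambda> *\<^sub>v v))\<^sup>2"
      by (rule order_trans) simp
    have "(l2_norm (submatrix D UNIV \<Lambda> *\<^sub>v v))\<^sup>2 \<le> C * (l2_norm v)\<^sup>2"
      unfolding U using C * by auto
    also have "\<dots> \<le> (1 + (1 + C)) * (l2_norm v)\<^sup>2"
      by (intro mult_right_mono) auto
    finally show "(l2_norm (submatrix D UNIV \<Lambda> *\<^sub>v v))\<^sup>2 \<le> (1 + (1 + C)) * (l2_norm v)\<^sup>2" .
  qed
  then have "?S \<noteq> {}" by blast
  moreover have "bdd_below ?S" by (rule bdd_belowI[of _ 0]) simp
  moreover have "closed ?S"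
    by (intro closed_Collect_conj closed_Collect_all closed_Collect_imp closed_Collect_le
        open_Collect_const continuous_intros)
  ultimately have "Inf ?S \<in> ?S" by (rule closed_contains_Inf)
  then have "rip_const s D \<in> ?S" unfolding rip_const_def .
  then show ?thesis unfolding mem_Collect_eq .
qed

section \<open>Pseudo-inverse of a matrix with independent columns\<close>

text \<open>\<open>A * X\<close> and \<open>A * Y\<close> are symmetric and each absorbs the other,
  so transposing a product of the two shows them equal; likewise \<open>X * A\<close> and
  \<open>Y * A\<close>. Then X = XAX = XAY = YAY = Y. This makes the \<open>THE\<close> in
  \<open>pseudo_inverse\<close> meaningful.\<close>

lemma is_pseudo_inverse_unique:
  assumes X: "is_pseudo_inverse A X" and Y: "is_pseudo_inverse A Y"
  shows "X = Y"
proof -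
  define r c where "r = dim_row A" and "c = dim_col A"
  have A: "A \<in> carrier_mat r c" by (simp add: r_def c_def)
  have Xc: "X \<in> carrier_mat c r" and AXA: "A * X * A = A" and XAX: "X * A * X = X"
    and tAX: "transpose_mat (A * X) = A * X" and tXA: "transpose_mat (X * A) = X * A"
    using X by (auto simp: is_pseudo_inverse_def r_def c_def)
  have Yc: "Y \<in> carrier_mat c r" and AYA: "A * Y * A = A" and YAY: "Y * A * Y = Y"
    and tAY: "transpose_mat (A * Y) = A * Y" and tYA: "transpose_mat (Y * A) = Y * A"
    using Y by (auto simp: is_pseudo_inverse_def r_def c_def)
  have AX: "A * X \<in> carrier_mat r r" and AY: "A * Y \<in> carrier_mat r r"
    and XA: "X * A \<in> carrier_mat c c" and YA: "Y * A \<in> carrier_mat c c"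
    using A Xc Yc by auto
  have "A * X = (A * Y) * (A * X)"
    using AYA assoc_mult_mat[OF AY A Xc] by simp
  also have "\<dots> = transpose_mat ((A * X) * (A * Y))"
    using transpose_mult[OF AX AY] tAX tAY by simp
  also have "(A * X) * (A * Y) = A * Y"
    using AXA assoc_mult_mat[OF AX A Yc] by simp
  finally have AXY: "A * X = A * Y" using tAY by simp
  have "X * A = (X * A) * (Y * A)"
    using AYA assoc_mult_mat[OF Xc A YA] assoc_mult_mat[OF A Yc A] by simp
  also have "\<dots> = transpose_mat ((Y * A) * (X * A))"
    using transpose_mult[OF YA XA] tXA tYA by simp
  also have "(Y * A) * (X * A) = Y * A"
    using AXA assoc_mult_mat[OF Yc A XA] assoc_mult_mat[OF A Xc A] by simp
  finally have XYA: "X * A = Y * A" using tYA by simp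
  have "X = X * (A * X)" using XAX assoc_mult_mat[OF Xc A Xc] by simp
  also have "\<dots> = Y * A * Y" unfolding AXY using assoc_mult_mat[OF Xc A Yc] XYA by simp
  finally show ?thesis using YAY by simp
qed

lemma pseudo_inverse_eqI: "is_pseudo_inverse A X \<Longrightarrow> pseudo_inverse A = X"
  unfolding pseudo_inverse_def using is_pseudo_inverse_unique by blast

lemma scalar_prod_self_eq_0:
  fixes v :: "real vec"
  assumes "v \<in> carrier_vec n" "scalar_prod v v = 0"
  shows "v = 0\<^sub>v n"
proof (rule eq_vecI)
  have "(\<Sum>l<n. (v $ l)\<^sup>2) = 0"
    using assms by (simp add: scalar_prod_def power2_eq_square lessThan_atLeast0)
  then show "v $ l = 0\<^sub>v n $ l" if "l < dim_vec (0\<^sub>v n)" for l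
    using that by (subst (asm) sum_nonneg_eq_0_iff) auto
qed (use assms in simp)

text \<open>If the Gram matrix kills \<open>v\<close>, then the squared norm of
  \<open>A *\<^sub>v v\<close> is 0, so injectivity gives v = 0. Hence its determinant is
  nonzero.\<close>

lemma gram_inverse:
  fixes A :: "real mat"
  assumes A: "A \<in> carrier_mat n s"
    and inj: "\<And>v. v \<in> carrier_vec s \<Longrightarrow> A *\<^sub>v v = 0\<^sub>v n \<Longrightarrow> v = 0\<^sub>v s"
  obtains G where "G \<in> carrier_mat s s" "G * (transpose_mat A * A) = 1\<^sub>m s"
    "transpose_mat G = G"
proof -
  define P where "P = transpose_mat A * A"
  have At: "transpose_mat A \<in> carrier_mat s n" using A by simp
  have P: "P \<in> carrier_mat s s" unfolding P_def using A by simp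
  have tP: "transpose_mat P = P"
    unfolding P_def using transpose_mult[OF At A] by simp
  have "det P \<noteq> 0"
  proof
    assume "det P = 0"
    then obtain v where v: "v \<in> carrier_vec s" "v \<noteq> 0\<^sub>v s" "P *\<^sub>v v = 0\<^sub>v s"
      using det_0_iff_vec_prod_zero[OF P] by auto
    have Av: "A *\<^sub>v v \<in> carrier_vec n" using A v by simp
    have "scalar_prod (A *\<^sub>v v) (A *\<^sub>v v) = scalar_prod (transpose_mat A *\<^sub>v (A *\<^sub>v v)) v"
      using transpose_vec_mult_scalar[OF A v(1) Av] by simp
    also have "transpose_mat A *\<^sub>v (A *\<^sub>v v) = 0\<^sub>v s"
      using v(3) assoc_mult_mat_vec[OF At A v(1)] unfolding P_def by simp
    finally have "scalar_prod (A *\<^sub>v v) (A *\<^sub>v v) = 0" using v(1) by simp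
    then show False using scalar_prod_self_eq_0[OF Av] inj v by blast
  qed
  then have "P \<in> Units (ring_mat TYPE(real) s ())" by (rule det_non_zero_imp_unit[OF P])
  then obtain G where G: "G \<in> carrier_mat s s" "G * P = 1\<^sub>m s" "P * G = 1\<^sub>m s"
    by (auto simp: Units_def ring_mat_def)
  have tG: "transpose_mat G \<in> carrier_mat s s" using G by simp
  \<comment> \<open>Transposing \<open>G * P = 1\<^sub>m s\<close> makes the transpose of
    \<open>G\<close> a right inverse of the symmetric \<open>P\<close>; it must agree with the left
    inverse \<open>G\<close>.\<close>
  have "P * transpose_mat G = 1\<^sub>m s"
    using transpose_mult[OF G(1) P] G(2) tP by simp
  then have "transpose_mat G = (G * P) * transpose_mat G" using G tG by simp
  also have "\<dots> = G"
    using assoc_mult_mat[OF G(1) P tG] \<open>P * transpose_mat G = 1\<^sub>m s\<close> G by simp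
  finally show thesis using that G unfolding P_def by blast
qed

text \<open>With independent columns the pseudo-inverse is the inverse Gram matrix times the
  transpose of \<open>A\<close>. The matrix \<open>G\<close> is exported because the transposed
  identity puts the rows of the pseudo-inverse in the column space of \<open>A\<close>.\<close>

lemma pseudo_inverse_left_inverse:
  fixes A :: "real mat"
  assumes A: "A \<in> carrier_mat n s"
    and inj: "\<And>v. v \<in> carrier_vec s \<Longrightarrow> A *\<^sub>v v = 0\<^sub>v n \<Longrightarrow> v = 0\<^sub>v s"
  obtains G where "G \<in> carrier_mat s s" "transpose_mat (pseudo_inverse A) = A * G"
    "pseudo_inverse A \<in> carrier_mat s n" "pseudo_inverse A * A = 1\<^sub>m s"
proof -
  obtain G where G: "G \<in> carrier_mat s s" and GP: "G * (transpose_mat A * A) = 1\<^sub>m s"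
    and tG: "transpose_mat G = G"
    using gram_inverse[OF A inj] by metis
  define X where "X = G * transpose_mat A"
  have At: "transpose_mat A \<in> carrier_mat s n" using A by simp
  have X: "X \<in> carrier_mat s n" unfolding X_def using G A by simp
  have XA: "X * A = 1\<^sub>m s"
    unfolding X_def using assoc_mult_mat[OF G At A] GP by simp
  have tX: "transpose_mat X = A * G"
    unfolding X_def using transpose_mult[OF G At] tG by simp
  have "transpose_mat (A * X) = A * G * transpose_mat A"
    using transpose_mult[OF A X] tX by simp
  also have "\<dots> = A * X" unfolding X_def using assoc_mult_mat[OF A G At] by simp
  finally have "transpose_mat (A * X) = A * X" .
  moreover have "A * X * A = A" using assoc_mult_mat[OF A X A] XA A by simp
  moreover have "X * A * X = X" using XA X by simp
  moreover have "transpose_mat (X * A) = X * A" using XA by simp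
  ultimately have "is_pseudo_inverse A X" using A X by (simp add: is_pseudo_inverse_def)
  then have "pseudo_inverse A = X" by (rule pseudo_inverse_eqI)
  then show thesis using that G tX X XA by metis
qed

text \<open>Each bound on the rows uses the opposite side of the near-isometry: \<open>lo\<close>,
  applied to the coefficients of a row in the columns of \<open>A\<close>, bounds the row from
  above; \<open>up\<close>, applied to a unit vector, bounds it from below.\<close>

lemma pseudo_inverse_near_isometry:
  fixes A :: "real mat"
  assumes A: "A \<in> carrier_mat n s" and \<delta>: "0 \<le> \<delta>" "\<delta> < 1"
    and lo: "\<And>v. v \<in> carrier_vec s \<Longrightarrow> (1 - \<delta>) * (l2_norm v)\<^sup>2 \<le> (l2_norm (A *\<^sub>v v))\<^sup>2"
    and up: "\<And>v. v \<in> carrier_vec s \<Longrightarrow> (l2_norm (A *\<^sub>v v))\<^sup>2 \<le> (1 + \<delta>) * (l2_norm v)\<^sup>2"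
  shows "pseudo_inverse A \<in> carrier_mat s n" "pseudo_inverse A * A = 1\<^sub>m s"
    "\<And>j. j < s \<Longrightarrow> 1 / (1 + \<delta>) \<le> (l2_norm (row (pseudo_inverse A) j))\<^sup>2"
    "\<And>j. j < s \<Longrightarrow> (l2_norm (row (pseudo_inverse A) j))\<^sup>2 \<le> 1 / (1 - \<delta>)"
proof -
  have inj: "v = 0\<^sub>v s" if v: "v \<in> carrier_vec s" and 0: "A *\<^sub>v v = 0\<^sub>v n" for v
  proof -
    have "(1 - \<delta>) * scalar_prod v v \<le> 0"
      using lo[OF v] unfolding 0 l2_norm_sq_scalar_prod by simp
    then have "scalar_prod v v = 0"
      using \<delta> scalar_prod_self_nonneg[of v] by (simp add: mult_le_0_iff)
    then show ?thesis by (rule scalar_prod_self_eq_0[OF v])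
  qed
  define X where "X = pseudo_inverse A"
  obtain G where G: "G \<in> carrier_mat s s" and tX: "transpose_mat X = A * G"
    and X: "X \<in> carrier_mat s n" and XA: "X * A = 1\<^sub>m s"
    unfolding X_def using pseudo_inverse_left_inverse[OF A inj] by metis
  show "pseudo_inverse A \<in> carrier_mat s n" "pseudo_inverse A * A = 1\<^sub>m s"
    using X XA by (simp_all add: X_def)
  fix j assume j: "j < s"
  define r where "r = row X j"
  have r: "r \<in> carrier_vec n" unfolding r_def using X by auto
  have r_col: "scalar_prod r (col A l) = (if j = l then 1 else 0)" if "l < s" for l
    using index_mult_mat(1)[of j X l A] XA X A j that by (simp add: r_def)
  \<comment> \<open>The coefficients of the row \<open>r\<close> as a combination of the columns of
    \<open>A\<close>.\<close>
  define g where "g = col G j"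
  have g: "g \<in> carrier_vec s" using G by (auto simp: g_def)
  have "r = col (transpose_mat X) j" using X j by (simp add: r_def)
  then have rg: "r = A *\<^sub>v g" using col_mult2[OF A G j] by (simp add: tX g_def)

  have At_r: "transpose_mat A *\<^sub>v r = unit_vec s j"
  proof (rule eq_vecI)
    show "dim_vec (transpose_mat A *\<^sub>v r) = dim_vec (unit_vec s j)" using A by simp
    fix l assume "l < dim_vec (unit_vec s j)"
    then have l: "l < s" by simp
    then have "col A l \<in> carrier_vec n" using A by auto
    then show "(transpose_mat A *\<^sub>v r) $ l = unit_vec s j $ l"
      using l j A r r_col[OF l] comm_scalar_prod[of r n "col A l"] by auto
  qed
  \<comment> \<open>Moving \<open>A\<close> across the inner product leaves a unit vector against
    \<open>g\<close>, so the squared norm of \<open>r\<close> is a single coordinate of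
    \<open>g\<close>.\<close>
  have "scalar_prod r r = scalar_prod (transpose_mat A *\<^sub>v r) g"
    using transpose_vec_mult_scalar[OF A g r] rg by simp
  then have rr: "scalar_prod r r = g $ j" using At_r g j by simp
  have "(g $ j)\<^sup>2 = (scalar_prod (unit_vec s j) g)\<^sup>2" using g j by simp
  also have "\<dots> \<le> scalar_prod (unit_vec s j) (unit_vec s j) * scalar_prod g g"
    using g by (intro scalar_prod_Cauchy_real) simp
  finally have "(scalar_prod r r)\<^sup>2 \<le> scalar_prod g g" using j rr by simp
  \<comment> \<open>As one coordinate is at most the whole norm, the lower isometry bound for
    \<open>g\<close> becomes a quadratic inequality in the squared norm of \<open>r\<close>.
    Cancelling one factor gives the upper bound, with the zero row treated separately.\<close>
  then have "(1 - \<delta>) * (scalar_prod r r)\<^sup>2 \<le> (1 - \<delta>) * scalar_prod g g"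
    using \<delta> by (intro mult_left_mono) auto
  also have "\<dots> \<le> scalar_prod r r"
    using lo[OF g] unfolding rg[symmetric] l2_norm_sq_scalar_prod .
  finally have t: "(1 - \<delta>) * (scalar_prod r r)\<^sup>2 \<le> scalar_prod r r" .
  have up_r: "scalar_prod r r \<le> 1 / (1 - \<delta>)"
  proof (cases "scalar_prod r r = 0")
    case False
    then have "0 < scalar_prod r r" using scalar_prod_self_nonneg[of r] by simp
    moreover have "((1 - \<delta>) * scalar_prod r r) * scalar_prod r r \<le> 1 * scalar_prod r r"
      using t by (simp add: power2_eq_square mult.assoc)
    ultimately have "(1 - \<delta>) * scalar_prod r r \<le> 1" by (simp only: mult_le_cancel_right_pos)
    then show ?thesis using \<delta> by (simp add: pos_le_divide_eq mult.commute)
  qed (use \<delta> in simp)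
  show "(l2_norm (row (pseudo_inverse A) j))\<^sup>2 \<le> 1 / (1 - \<delta>)"
    using up_r unfolding l2_norm_sq_scalar_prod r_def X_def .

  \<comment> \<open>The matching column has squared norm at most 1 + \<delta>, and Cauchy-Schwarz
    against the inner product 1 keeps the row from being short.\<close>
  have "A *\<^sub>v unit_vec s j = col A j"
    using A j by (intro eq_vecI) auto
  moreover have "(l2_norm (unit_vec s j))\<^sup>2 = 1" using j by (simp add: l2_norm_sq_scalar_prod)
  ultimately have c: "scalar_prod (col A j) (col A j) \<le> 1 + \<delta>"
    using up[of "unit_vec s j"] by (simp add: l2_norm_sq_scalar_prod)
  have "1 = (scalar_prod r (col A j))\<^sup>2" using r_col[OF j] by simp
  also have "\<dots> \<le> scalar_prod r r * scalar_prod (col A j) (col A j)"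
    using r A by (intro scalar_prod_Cauchy_real) auto
  also have "\<dots> \<le> scalar_prod r r * (1 + \<delta>)"
    using c scalar_prod_self_nonneg by (rule mult_left_mono)
  finally show "1 / (1 + \<delta>) \<le> (l2_norm (row (pseudo_inverse A) j))\<^sup>2"
    using \<delta> unfolding l2_norm_sq_scalar_prod r_def X_def by (simp add: field_simps)
qed

section \<open>Second moments of linear images of white noise\<close>

text \<open>For \<sigma> = 0 there is no density, so everything is read off from the almost sure
  value 0; otherwise the moments of the normal density are transported along
  \<open>distributed\<close>.\<close>

lemma (in prob_space) white_gaussian_moments:
  assumes "0 \<le> \<sigma>" and wg: "white_gaussian n \<sigma> e" and l: "l < n"
  shows "integrable M (\<lambda>\<omega>. e \<omega> $ l)" "expectation (\<lambda>\<omega>. e \<omega> $ l) = 0"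
    "integrable M (\<lambda>\<omega>. (e \<omega> $ l)\<^sup>2)" "expectation (\<lambda>\<omega>. (e \<omega> $ l)\<^sup>2) = \<sigma>\<^sup>2"
proof -
  have meas [measurable]: "(\<lambda>\<omega>. e \<omega> $ l) \<in> borel_measurable M"
    using wg l by (auto simp: white_gaussian_def indep_vars_def)
  have "integrable M (\<lambda>\<omega>. e \<omega> $ l) \<and> expectation (\<lambda>\<omega>. e \<omega> $ l) = 0 \<and>
    integrable M (\<lambda>\<omega>. (e \<omega> $ l)\<^sup>2) \<and> expectation (\<lambda>\<omega>. (e \<omega> $ l)\<^sup>2) = \<sigma>\<^sup>2"
  proof (cases "\<sigma> = 0")
    case True
    then have ae: "AE \<omega> in M. e \<omega> $ l = 0" using wg l by (auto simp: white_gaussian_def)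
    then have ae2: "AE \<omega> in M. (e \<omega> $ l)\<^sup>2 = 0" by eventually_elim simp
    have "integrable M (\<lambda>\<omega>. e \<omega> $ l) \<longleftrightarrow> integrable M (\<lambda>\<omega>. 0 :: real)"
      using ae by (intro integrable_cong_AE) auto
    moreover have "expectation (\<lambda>\<omega>. e \<omega> $ l) = expectation (\<lambda>\<omega>. 0)"
      using ae by (intro integral_cong_AE) auto
    moreover have "integrable M (\<lambda>\<omega>. (e \<omega> $ l)\<^sup>2) \<longleftrightarrow> integrable M (\<lambda>\<omega>. 0 :: real)"
      using ae2 by (intro integrable_cong_AE) auto
    moreover have "expectation (\<lambda>\<omega>. (e \<omega> $ l)\<^sup>2) = expectation (\<lambda>\<omega>. 0)"
      using ae2 by (intro integral_cong_AE) auto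
    ultimately show ?thesis using True by simp
  next
    case False
    then have pos: "0 < \<sigma>" using \<open>0 \<le> \<sigma>\<close> by simp
    have d: "distributed M lborel (\<lambda>\<omega>. e \<omega> $ l) (\<lambda>x. ennreal (normal_density 0 \<sigma> x))"
      using wg l False by (auto simp: white_gaussian_def)
    note m1 = normal_moment_nz_1[OF pos, of 0]
    have m2: "has_bochner_integral lborel (\<lambda>x. normal_density 0 \<sigma> x * x\<^sup>2) (\<sigma>\<^sup>2)"
      using normal_moment_even[OF pos, of 0 1] by simp
    note i1 = distributed_integrable[OF d, of "\<lambda>x. x"] distributed_integral[OF d, of "\<lambda>x. x"]
    note i2 = distributed_integrable[OF d, of "\<lambda>x. x\<^sup>2"] distributed_integral[OF d, of "\<lambda>x. x\<^sup>2"]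
    show ?thesis
      using i1 i2 m1 m2 by (simp add: has_bochner_integral_iff)
  qed
  then show "integrable M (\<lambda>\<omega>. e \<omega> $ l)" "expectation (\<lambda>\<omega>. e \<omega> $ l) = 0"
    "integrable M (\<lambda>\<omega>. (e \<omega> $ l)\<^sup>2)" "expectation (\<lambda>\<omega>. (e \<omega> $ l)\<^sup>2) = \<sigma>\<^sup>2" by auto
qed

lemma (in prob_space) white_gaussian_covariance:
  assumes "0 \<le> \<sigma>" and wg: "white_gaussian n \<sigma> e" and l: "l < n" "l' < n"
  shows "integrable M (\<lambda>\<omega>. e \<omega> $ l * e \<omega> $ l')"
    "expectation (\<lambda>\<omega>. e \<omega> $ l * e \<omega> $ l') = (if l = l' then \<sigma>\<^sup>2 else 0)"
proof -
  note m = white_gaussian_moments[OF assms(1) wg]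
  have "integrable M (\<lambda>\<omega>. e \<omega> $ l * e \<omega> $ l') \<and>
    expectation (\<lambda>\<omega>. e \<omega> $ l * e \<omega> $ l') = (if l = l' then \<sigma>\<^sup>2 else 0)"
  proof (cases "l = l'")
    case True
    then show ?thesis using m(3,4)[OF l(1)] by (simp add: power2_eq_square)
  next
    case False
    have ind: "indep_vars (\<lambda>_. borel) (\<lambda>l \<omega>. e \<omega> $ l) {l, l'}"
      using wg l by (auto simp: white_gaussian_def intro: indep_vars_subset)
    \<comment> \<open>Independence is stated for products over an index set; since the indices
      differ, this product really has two factors, each of mean 0.\<close>
    have "integrable M (\<lambda>\<omega>. \<Prod>i\<in>{l, l'}. e \<omega> $ i)"
      using ind m(1) l by (intro indep_vars_integrable) auto
    moreover have "expectation (\<lambda>\<omega>. \<Prod>i\<in>{l, l'}. e \<omega> $ i) = (\<Prod>i\<in>{l, l'}. expectation (\<lambda>\<omega>. e \<omega> $ i))"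
      using ind m(1) l by (intro indep_vars_lebesgue_integral) auto
    ultimately show ?thesis using False m(2) l by simp
  qed
  then show "integrable M (\<lambda>\<omega>. e \<omega> $ l * e \<omega> $ l')"
    "expectation (\<lambda>\<omega>. e \<omega> $ l * e \<omega> $ l') = (if l = l' then \<sigma>\<^sup>2 else 0)" by auto
qed

text \<open>Expand the squared norm into products of two noise coordinates; in expectation only the
  diagonal terms survive.\<close>

lemma (in prob_space) white_gaussian_linear_image:
  assumes \<sigma>: "0 \<le> \<sigma>" and wg: "white_gaussian n \<sigma> e" and W: "W \<in> carrier_mat r n"
  shows "integrable M (\<lambda>\<omega>. (l2_norm (W *\<^sub>v e \<omega>))\<^sup>2)"
    "expectation (\<lambda>\<omega>. (l2_norm (W *\<^sub>v e \<omega>))\<^sup>2) = \<sigma>\<^sup>2 * (\<Sum>j<r. (l2_norm (row W j))\<^sup>2)"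
proof -
  note cov = white_gaussian_covariance[OF \<sigma> wg]
  let ?q = "\<lambda>\<omega>. \<Sum>j<r. \<Sum>l<n. \<Sum>l'<n. (W $$ (j, l) * W $$ (j, l')) * (e \<omega> $ l * e \<omega> $ l')"
  have q: "(l2_norm (W *\<^sub>v e \<omega>))\<^sup>2 = ?q \<omega>" if "\<omega> \<in> space M" for \<omega>
  proof -
    have "e \<omega> \<in> carrier_vec n" using wg that by (auto simp: white_gaussian_def)
    then have "(W *\<^sub>v e \<omega>) $ j = (\<Sum>l<n. W $$ (j, l) * e \<omega> $ l)" if "j < r" for j
      using W that by (subst mult_mat_vec_index) auto
    then have "(l2_norm (W *\<^sub>v e \<omega>))\<^sup>2 = (\<Sum>j<r. (\<Sum>l<n. W $$ (j, l) * e \<omega> $ l)\<^sup>2)"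
      using W by (simp add: l2_norm_sq del: index_mult_mat_vec)
    then show ?thesis by (simp add: power2_eq_square sum_product mult_ac)
  qed
  let ?I = "\<Sum>j<r. \<Sum>l<n. \<Sum>l'<n. (W $$ (j, l) * W $$ (j, l')) * (if l = l' then \<sigma>\<^sup>2 else 0)"
  \<comment> \<open>\<open>?I\<close> is \<open>?q\<close> with every product of noise coordinates
    replaced by its covariance; one statement yields integrability and value together.\<close>
  have hbi: "has_bochner_integral M ?q ?I"
    using cov
    by (intro has_bochner_integral_sum has_bochner_integral_mult_right)
      (simp_all add: has_bochner_integral_iff)
  then have "integrable M ?q" by (rule integrable.intros)
  then show "integrable M (\<lambda>\<omega>. (l2_norm (W *\<^sub>v e \<omega>))\<^sup>2)"
    using q by (simp cong: Bochner_Integration.integrable_cong)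
  have "expectation (\<lambda>\<omega>. (l2_norm (W *\<^sub>v e \<omega>))\<^sup>2) = expectation ?q"
    using q by (intro Bochner_Integration.integral_cong) auto
  also have "\<dots> = ?I" using hbi by (rule has_bochner_integral_integral_eq)
  also have "\<dots> = (\<Sum>j<r. \<sigma>\<^sup>2 * (l2_norm (row W j))\<^sup>2)"
  proof (intro sum.cong refl)
    fix j assume "j \<in> {..<r}"
    then have row: "(l2_norm (row W j))\<^sup>2 = (\<Sum>l<n. (W $$ (j, l))\<^sup>2)"
      using W by (simp add: l2_norm_sq)
    have "(\<Sum>l'<n. W $$ (j, l) * W $$ (j, l') * (if l = l' then \<sigma>\<^sup>2 else 0))
        = \<sigma>\<^sup>2 * (W $$ (j, l))\<^sup>2" if "l < n" for l
    proof -
      have "(\<Sum>l'<n. W $$ (j, l) * W $$ (j, l') * (if l = l' then \<sigma>\<^sup>2 else 0))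
          = (\<Sum>l'<n. if l = l' then W $$ (j, l) * W $$ (j, l') * \<sigma>\<^sup>2 else 0)"
        by (intro sum.cong) auto
      then show ?thesis using that by (simp add: power2_eq_square mult_ac)
    qed
    then show "(\<Sum>l<n. \<Sum>l'<n. W $$ (j, l) * W $$ (j, l') * (if l = l' then \<sigma>\<^sup>2 else 0))
        = \<sigma>\<^sup>2 * (l2_norm (row W j))\<^sup>2"
      by (simp add: row sum_distrib_left)
  qed
  finally show "expectation (\<lambda>\<omega>. (l2_norm (W *\<^sub>v e \<omega>))\<^sup>2) = \<sigma>\<^sup>2 * (\<Sum>j<r. (l2_norm (row W j))\<^sup>2)"
    by (simp add: sum_distrib_left)
qed

section \<open>Chaining one-layer inequalities\<close>

lemma interval_prod_upper:
  fixes N h :: "nat \<Rightarrow> real"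
  assumes "i \<le> k" and step: "\<And>j. i \<le> j \<Longrightarrow> j < k \<Longrightarrow> N j \<le> h (Suc j) * N (Suc j)"
    and nonneg: "\<And>j. i < j \<Longrightarrow> j \<le> k \<Longrightarrow> 0 \<le> h j"
  shows "N i \<le> (\<Prod>j=i+1..k. h j) * N k"
  \<comment> \<open>Induction downwards from \<open>k\<close>. Only the factors need a sign, so
    \<open>N\<close> may be negative; the lower version exploits this by passing to
    \<open>- N\<close>.\<close>
  using \<open>i \<le> k\<close>
proof (induction rule: inc_induct)
  case (step j)
  have "N j \<le> h (Suc j) * N (Suc j)" using step.hyps assms(2) by simp
  also have "\<dots> \<le> h (Suc j) * ((\<Prod>l=Suc j+1..k. h l) * N k)"
    using step nonneg by (intro mult_left_mono) auto
  also have "\<dots> = (\<Prod>l=j+1..k. h l) * N k"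
    using step.hyps by (simp add: prod.atLeast_Suc_atMost)
  finally show ?case .
qed simp

lemma interval_prod_lower:
  fixes N h :: "nat \<Rightarrow> real"
  assumes "i \<le> k" and step: "\<And>j. i \<le> j \<Longrightarrow> j < k \<Longrightarrow> h (Suc j) * N (Suc j) \<le> N j"
    and nonneg: "\<And>j. i < j \<Longrightarrow> j \<le> k \<Longrightarrow> 0 \<le> h j"
  shows "(\<Prod>j=i+1..k. h j) * N k \<le> N i"
  using interval_prod_upper[of i k "\<lambda>j. - N j" h] assms by simp

section \<open>Difference vectors and the effective dictionary\<close>

lemma l2_norm_minus_commute:
  assumes "v \<in> carrier_vec n" "w \<in> carrier_vec n"
  shows "l2_norm (v - w) = l2_norm (w - v)"
  using assms by (simp add: l2_norm_def power2_commute)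

lemma vec_support_minus:
  assumes "v \<in> carrier_vec n" "w \<in> carrier_vec n"
  shows "vec_support (v - w) \<subseteq> vec_support v \<union> vec_support w"
  using assms by (auto simp: vec_support_def)

lemma dict_prod_carrier:
  assumes "D 1 \<in> carrier_mat n (m 1)"
    and "\<And>i. i \<in> {2..k} \<Longrightarrow> D i \<in> carrier_mat (m (i - 1)) (m i)"
    and "1 \<le> j" "j \<le> k"
  shows "dict_prod D j \<in> carrier_mat n (m j)"
  using assms(3,4)
proof (induction j rule: dec_induct)
  case (step j)
  then have "D (Suc j) \<in> carrier_mat (m j) (m (Suc j))" using assms(2)[of "Suc j"] by simp
  then show ?case using step by simp
qed (use assms in simp)

text \<open>The last factor turns \<open>\<gamma> (Suc j)\<close> into \<open>\<gamma> j\<close>, so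
  the product is peeled off from the right.\<close>

lemma dict_prod_mult_vec:
  assumes D1: "D 1 \<in> carrier_mat n (m 1)"
    and D: "\<And>i. i \<in> {2..k} \<Longrightarrow> D i \<in> carrier_mat (m (i - 1)) (m i)"
    and \<gamma>_dim: "\<And>i. i \<in> {1..k} \<Longrightarrow> \<gamma> i \<in> carrier_vec (m i)"
    and \<gamma>: "\<And>i. i \<in> {2..k} \<Longrightarrow> \<gamma> (i - 1) = D i *\<^sub>v \<gamma> i"
    and j: "1 \<le> j" "j \<le> k"
  shows "dict_prod D j *\<^sub>v \<gamma> j = D 1 *\<^sub>v \<gamma> 1"
  using j
proof (induction j rule: dec_induct)
  case (step j)
  have "D (Suc j) \<in> carrier_mat (m j) (m (Suc j))" using step D[of "Suc j"] by simp
  moreover have "dict_prod D j \<in> carrier_mat n (m j)"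
    using step by (intro dict_prod_carrier[where k = k] D1 D) auto
  moreover have "\<gamma> (Suc j) \<in> carrier_vec (m (Suc j))" using step \<gamma>_dim by simp
  moreover have "\<gamma> j = D (Suc j) *\<^sub>v \<gamma> (Suc j)" using step \<gamma>[of "Suc j"] by simp
  ultimately show ?case using step by (simp add: assoc_mult_mat_vec)
qed (use D1 in simp)

text \<open>Integrability is part of the claim because the integral of a non-integrable function is
  0 by convention. The lower bound has a side condition: a negative factor reverses an inequality
  when the layers are chained, so a product that is positive through an even number of negative
  factors is not reached by this argument.\<close>

theorem mainTheorem3:
  fixes M :: "'a measure" and e y :: "'a \<Rightarrow> real vec" and \<sigma> :: real
    and n k :: nat and m s :: "nat \<Rightarrow> nat" and D :: "nat \<Rightarrow> real mat"
    and x :: "real vec" and \<gamma> :: "nat \<Rightarrow> real vec" and \<Lambda> :: "nat \<Rightarrow> nat set"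
    and \<gamma>h :: "nat \<Rightarrow> 'a \<Rightarrow> real vec"
  assumes D1: "D 1 \<in> carrier_mat n (m 1)"
    and D: "\<And>i. i \<in> {2..k} \<Longrightarrow> D i \<in> carrier_mat (m (i - 1)) (m i)"
    and \<gamma>_dim: "\<And>i. i \<in> {1..k} \<Longrightarrow> \<gamma> i \<in> carrier_vec (m i)"
    and supp: "\<And>i. i \<in> {1..k} \<Longrightarrow> vec_support (\<gamma> i) = \<Lambda> i"
    and s: "\<And>i. i \<in> {1..k} \<Longrightarrow> card (\<Lambda> i) = s i"
    and x: "x = D 1 *\<^sub>v \<gamma> 1"
    and \<gamma>: "\<And>i. i \<in> {2..k} \<Longrightarrow> \<gamma> (i - 1) = D i *\<^sub>v \<gamma> i"
    and "prob_space M" and "0 \<le> \<sigma>"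
    and noise: "prob_space.white_gaussian M n \<sigma> e"
    and y: "\<And>\<omega>. \<omega> \<in> space M \<Longrightarrow> y \<omega> = x + e \<omega>"
    and rip: "rip_const (s k) (dict_prod D k) < 1"
    and estim: "\<And>\<omega>. \<omega> \<in> space M \<Longrightarrow> projection_oracle k m D \<Lambda> (y \<omega>) (\<lambda>i. \<gamma>h i \<omega>)"
  shows "\<forall>i. 1 \<le> i \<and> i \<le> k - 1 \<longrightarrow>
    integrable M (\<lambda>\<omega>. (l2_norm (\<gamma> i - \<gamma>h i \<omega>))\<^sup>2) \<and>
    ((\<forall>j\<in>{i+1..k}. 0 \<le> real (s (j - 1)) / real (m (j - 1)) - subset_rip_const (s (j - 1)) (s j) (D j))
      \<or> (\<Prod>j=i+1..k. real (s (j - 1)) / real (m (j - 1)) - subset_rip_const (s (j - 1)) (s j) (D j)) \<le> 0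
      \<longrightarrow>
      \<sigma>\<^sup>2 * real (s k) * ((\<Prod>j=i+1..k. real (s (j - 1)) / real (m (j - 1)) - subset_rip_const (s (j - 1)) (s j) (D j))
          / (1 + rip_const (s k) (dict_prod D k)))
        \<le> (LINT \<omega>|M. (l2_norm (\<gamma> i - \<gamma>h i \<omega>))\<^sup>2)) \<and>
    (LINT \<omega>|M. (l2_norm (\<gamma> i - \<gamma>h i \<omega>))\<^sup>2)
      \<le> \<sigma>\<^sup>2 * real (s k) * ((\<Prod>j=i+1..k. real (s (j - 1)) / real (m (j - 1)) + subset_rip_const (s (j - 1)) (s j) (D j))
          / (1 - rip_const (s k) (dict_prod D k)))"
proof (intro allI impI)
  fix i assume i_range: "1 \<le> i \<and> i \<le> k - 1"
  then have i: "1 \<le> i" "i \<le> k" and k: "1 \<le> k" "k \<in> {1..k}" by auto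
  interpret prob_space M by fact
  have e: "e \<omega> \<in> carrier_vec n" if "\<omega> \<in> space M" for \<omega>
    using noise that by (simp add: white_gaussian_def)
  have \<Lambda>: "\<Lambda> j \<subseteq> {..<m j}" if "j \<in> {1..k}" for j
    using supp[OF that] \<gamma>_dim[OF that] by (auto simp: vec_support_def)
  have \<gamma>h: "\<gamma>h j \<omega> \<in> carrier_vec (m j)" "vec_support (\<gamma>h j \<omega>) \<subseteq> \<Lambda> j"
    if "\<omega> \<in> space M" "j \<in> {1..k}" for j \<omega>
    using estim[OF that(1)] that(2) by (auto simp: projection_oracle_def)
  have D': "D (Suc j) \<in> carrier_mat (m j) (m (Suc j))" if "1 \<le> j" "j < k" for j
    using D[of "Suc j"] that by simp
  \<comment> \<open>Estimate minus truth, so that the deepest error is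
    \<open>X *\<^sub>v e \<omega>\<close> without a sign. Both vectors vanish outside the support,
    hence restricting to it loses no norm.\<close>
  define err where "err j \<omega> = subvector (\<gamma>h j \<omega> - \<gamma> j) (\<Lambda> j)" for j \<omega>
  define S where "S j = submatrix (D (Suc j)) (\<Lambda> j) (\<Lambda> (Suc j))" for j
  have diff: "\<gamma>h j \<omega> - \<gamma> j \<in> carrier_vec (m j)" "vec_support (\<gamma>h j \<omega> - \<gamma> j) \<subseteq> \<Lambda> j"
    if "\<omega> \<in> space M" "j \<in> {1..k}" for j \<omega>
    using \<gamma>h[OF that] \<gamma>_dim[OF that(2)] supp[OF that(2)]
      vec_support_minus[OF \<gamma>h(1)[OF that] \<gamma>_dim[OF that(2)]] by auto
  have err_carrier: "err j \<omega> \<in> carrier_vec (s j)" if "\<omega> \<in> space M" "j \<in> {1..k}" for j \<omega>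
    using subvector_carrier[OF diff(1)[OF that] \<Lambda>[OF that(2)]] s[OF that(2)] by (simp add: err_def)
  have err_eq: "err j \<omega> = subvector (\<gamma>h j \<omega>) (\<Lambda> j) - subvector (\<gamma> j) (\<Lambda> j)"
    if "\<omega> \<in> space M" "j \<in> {1..k}" for j \<omega>
    unfolding err_def
    by (rule subvector_minus[OF \<gamma>h(1)[OF that] \<gamma>_dim[OF that(2)] \<Lambda>[OF that(2)]])
  have norm_err: "l2_norm (\<gamma> j - \<gamma>h j \<omega>) = l2_norm (err j \<omega>)"
    if "\<omega> \<in> space M" "j \<in> {1..k}" for j \<omega>
    using l2_norm_minus_commute[OF \<gamma>_dim[OF that(2)] \<gamma>h(1)[OF that]]
      l2_norm_subvector[OF diff(1)[OF that] \<Lambda>[OF that(2)] diff(2)[OF that]]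
    by (simp add: err_def)
  have S: "S j \<in> carrier_mat (s j) (s (Suc j))" if "1 \<le> j" "j < k" for j
    using submatrix_carrier[OF D'[OF that] \<Lambda> \<Lambda>] s[of j] s[of "Suc j"] that by (simp add: S_def)
  \<comment> \<open>Estimate and truth obey the same recursion with matrix \<open>S j\<close>: the
    former by definition of the estimator, the latter by the support of
    \<open>\<gamma> (Suc j)\<close>. Their difference therefore obeys it too.\<close>
  have err_step: "err j \<omega> = S j *\<^sub>v err (Suc j) \<omega>"
    if \<omega>: "\<omega> \<in> space M" and j: "1 \<le> j" "j < k" for j \<omega>
  proof -
    have j': "j \<in> {1..k}" "Suc j \<in> {1..k}" "j \<in> {1..<k}" using j by auto
    have "subvector (\<gamma>h j \<omega>) (\<Lambda> j) = S j *\<^sub>v subvector (\<gamma>h (Suc j) \<omega>) (\<Lambda> (Suc j))"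
      using estim[OF \<omega>] j'(3) by (simp add: projection_oracle_def S_def)
    moreover have "subvector (\<gamma> j) (\<Lambda> j) = S j *\<^sub>v subvector (\<gamma> (Suc j)) (\<Lambda> (Suc j))"
      unfolding S_def
      using submatrix_mult_subvector[OF D'[OF j] \<Lambda>[OF j'(1)] \<Lambda>[OF j'(2)] \<gamma>_dim[OF j'(2)]]
        supp[OF j'(2)] \<gamma>[of "Suc j"] j by simp
    moreover have "subvector (\<gamma>h (Suc j) \<omega>) (\<Lambda> (Suc j)) \<in> carrier_vec (s (Suc j))"
      "subvector (\<gamma> (Suc j)) (\<Lambda> (Suc j)) \<in> carrier_vec (s (Suc j))"
      using subvector_carrier[OF \<gamma>h(1)[OF \<omega> j'(2)] \<Lambda>[OF j'(2)]]
        subvector_carrier[OF \<gamma>_dim[OF j'(2)] \<Lambda>[OF j'(2)]] s[OF j'(2)] by simp_all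
    ultimately show ?thesis
      using err_eq[OF \<omega> j'(1)] err_eq[OF \<omega> j'(2)] mult_minus_distrib_mat_vec[OF S[OF j]] by metis
  qed

  let ?\<delta> = "rip_const (s k) (dict_prod D k)"
  define A where "A = submatrix (dict_prod D k) UNIV (\<Lambda> k)"
  define X where "X = pseudo_inverse A"
  have dp: "dict_prod D k \<in> carrier_mat n (m k)"
    using k by (intro dict_prod_carrier[where k = k] D1 D) auto
  have A_eq: "A = submatrix (dict_prod D k) {..<n} (\<Lambda> k)"
    unfolding A_def by (rule submatrix_UNIV_row[OF dp])
  have A: "A \<in> carrier_mat n (s k)"
    unfolding A_eq using submatrix_carrier[OF dp order_refl \<Lambda>[OF k(2)]] s[OF k(2)] by simp
  have \<delta>: "0 \<le> ?\<delta>" using rip_const_attained by blast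
  have "(1 - ?\<delta>) * (l2_norm v)\<^sup>2 \<le> (l2_norm (A *\<^sub>v v))\<^sup>2 \<and>
      (l2_norm (A *\<^sub>v v))\<^sup>2 \<le> (1 + ?\<delta>) * (l2_norm v)\<^sup>2" if "v \<in> carrier_vec (s k)" for v
    using rip_const_attained[of "s k" "dict_prod D k"] \<Lambda>[OF k(2)] s[OF k(2)] dp that
    unfolding A_def by simp
  then have X: "X \<in> carrier_mat (s k) n" and XA: "X * A = 1\<^sub>m (s k)"
    and X_lo: "\<And>j. j < s k \<Longrightarrow> 1 / (1 + ?\<delta>) \<le> (l2_norm (row X j))\<^sup>2"
    and X_up: "\<And>j. j < s k \<Longrightarrow> (l2_norm (row X j))\<^sup>2 \<le> 1 / (1 - ?\<delta>)"
    unfolding X_def using pseudo_inverse_near_isometry[OF A \<delta> rip] by blast+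
  \<comment> \<open>Since \<open>X\<close> is a left inverse of \<open>A\<close>, it recovers the
    true coefficients from the signal part \<open>x\<close> of the observation, and only the
    filtered noise remains.\<close>
  have err_k: "err k \<omega> = X *\<^sub>v e \<omega>" if \<omega>: "\<omega> \<in> space M" for \<omega>
  proof -
    let ?g = "subvector (\<gamma> k) (\<Lambda> k)"
    have g: "?g \<in> carrier_vec (s k)"
      using subvector_carrier[OF \<gamma>_dim[OF k(2)] \<Lambda>[OF k(2)]] s[OF k(2)] by simp
    have xc: "x \<in> carrier_vec n" using x D1 \<gamma>_dim[of 1] k by simp
    have "A *\<^sub>v ?g = subvector (dict_prod D k *\<^sub>v \<gamma> k) {..<n}"
      unfolding A_eq using supp[OF k(2)]
      by (intro submatrix_mult_subvector[OF dp order_refl \<Lambda>[OF k(2)] \<gamma>_dim[OF k(2)]]) simp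
    also have "\<dots> = x"
      using dict_prod_mult_vec[OF D1 D \<gamma>_dim \<gamma> k(1) order_refl] x subvector_lessThan[OF xc] by simp
    finally have Ag: "A *\<^sub>v ?g = x" .
    have "X *\<^sub>v x = ?g" using assoc_mult_mat_vec[OF X A g] XA g Ag by simp
    then have "subvector (\<gamma>h k \<omega>) (\<Lambda> k) = ?g + X *\<^sub>v e \<omega>"
      using estim[OF \<omega>] y[OF \<omega>] mult_add_distrib_mat_vec[OF X xc e[OF \<omega>]]
      by (simp add: projection_oracle_def A_def X_def)
    then show ?thesis using err_eq[OF \<omega> k(2)] g X by (intro eq_vecI) auto
  qed

  \<comment> \<open>A fixed matrix expressing the error through the noise supplies measurability as
    well as integrability; the pointwise norm bounds alone would not give measurability.\<close>
  have linear: "\<exists>W\<in>carrier_mat (s i) n. \<forall>\<omega>\<in>space M. err i \<omega> = W *\<^sub>v e \<omega>"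
    using i(2)
  proof (induction rule: inc_induct)
    case base
    then show ?case using X err_k by blast
  next
    case (step j)
    then obtain W where W: "W \<in> carrier_mat (s (Suc j)) n"
      "\<And>\<omega>. \<omega> \<in> space M \<Longrightarrow> err (Suc j) \<omega> = W *\<^sub>v e \<omega>" by blast
    have j: "1 \<le> j" "j < k" using step i by auto
    have "S j * W \<in> carrier_mat (s j) n" using S[OF j] W by simp
    moreover have "err j \<omega> = (S j * W) *\<^sub>v e \<omega>" if "\<omega> \<in> space M" for \<omega>
      using err_step[OF that j] W(2)[OF that] assoc_mult_mat_vec[OF S[OF j] W(1) e[OF that]] by simp
    ultimately show ?case by blast
  qed
  have integrable_err: "integrable M (\<lambda>\<omega>. (l2_norm (\<gamma> i - \<gamma>h i \<omega>))\<^sup>2)"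
  proof -
    obtain W where W: "W \<in> carrier_mat (s i) n" "\<forall>\<omega>\<in>space M. err i \<omega> = W *\<^sub>v e \<omega>"
      using linear by blast
    have "integrable M (\<lambda>\<omega>. (l2_norm (W *\<^sub>v e \<omega>))\<^sup>2)"
      by (rule white_gaussian_linear_image(1)[OF \<open>0 \<le> \<sigma>\<close> noise W(1)])
    then show ?thesis
      using W(2) norm_err i by (simp cong: Bochner_Integration.integrable_cong)
  qed
  note X_int = white_gaussian_linear_image[OF \<open>0 \<le> \<sigma>\<close> noise X]

  \<comment> \<open>The index \<open>j\<close> refers to \<open>D j\<close>, whose row count is
    \<open>m (j - 1)\<close>; passing from layer \<open>Suc j\<close> to layer \<open>j\<close> thus
    uses the factor with index \<open>Suc j\<close>.\<close>
  define q \<delta>' where "q j = real (s (j - 1)) / real (m (j - 1))"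
    and "\<delta>' j = subset_rip_const (s (j - 1)) (s j) (D j)" for j
  have step: "(q (Suc j) - \<delta>' (Suc j)) * (l2_norm (err (Suc j) \<omega>))\<^sup>2 \<le> (l2_norm (err j \<omega>))\<^sup>2"
    "(l2_norm (err j \<omega>))\<^sup>2 \<le> (q (Suc j) + \<delta>' (Suc j)) * (l2_norm (err (Suc j) \<omega>))\<^sup>2"
    if \<omega>: "\<omega> \<in> space M" and j: "1 \<le> j" "j < k" for j \<omega>
  proof -
    have j': "j \<in> {1..k}" "Suc j \<in> {1..k}" using j by auto
    show "(q (Suc j) - \<delta>' (Suc j)) * (l2_norm (err (Suc j) \<omega>))\<^sup>2 \<le> (l2_norm (err j \<omega>))\<^sup>2"
      "(l2_norm (err j \<omega>))\<^sup>2 \<le> (q (Suc j) + \<delta>' (Suc j)) * (l2_norm (err (Suc j) \<omega>))\<^sup>2"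
      using subset_rip_const_attained[of "s j" "s (Suc j)" "D (Suc j)"] D'[OF j]
        \<Lambda>[OF j'(1)] \<Lambda>[OF j'(2)] s[OF j'(1)] s[OF j'(2)] err_carrier[OF \<omega> j'(2)]
      by (simp_all add: err_step[OF \<omega> j] S_def q_def \<delta>'_def)
  qed
  have E_k: "expectation (\<lambda>\<omega>. c * (l2_norm (X *\<^sub>v e \<omega>))\<^sup>2)
      = c * (\<sigma>\<^sup>2 * (\<Sum>j<s k. (l2_norm (row X j))\<^sup>2))" for c
    using X_int(2) by simp
  have sum_up: "(\<Sum>j<s k. (l2_norm (row X j))\<^sup>2) \<le> real (s k) / (1 - ?\<delta>)"
    using sum_mono[of "{..<s k}" "\<lambda>j. (l2_norm (row X j))\<^sup>2" "\<lambda>_. 1 / (1 - ?\<delta>)"] X_up by simp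
  have sum_lo: "real (s k) / (1 + ?\<delta>) \<le> (\<Sum>j<s k. (l2_norm (row X j))\<^sup>2)"
    using sum_mono[of "{..<s k}" "\<lambda>_. 1 / (1 + ?\<delta>)" "\<lambda>j. (l2_norm (row X j))\<^sup>2"] X_lo by simp

  \<comment> \<open>Both summands are nonnegative, so the upper chain can always be multiplied out
    and the upper bound carries no side condition.\<close>
  have factor_nonneg: "0 \<le> q j + \<delta>' j" for j
    using subset_rip_const_attained[of "s (j - 1)" "s j" "D j"] by (simp add: q_def \<delta>'_def)
  define Pu Pl where "Pu = (\<Prod>j=i+1..k. q j + \<delta>' j)" and "Pl = (\<Prod>j=i+1..k. q j - \<delta>' j)"
  have Pu: "0 \<le> Pu" unfolding Pu_def using factor_nonneg by (intro prod_nonneg) simp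
  have "(LINT \<omega>|M. (l2_norm (\<gamma> i - \<gamma>h i \<omega>))\<^sup>2) \<le> expectation (\<lambda>\<omega>. Pu * (l2_norm (X *\<^sub>v e \<omega>))\<^sup>2)"
  proof (rule integral_mono[OF integrable_err])
    show "integrable M (\<lambda>\<omega>. Pu * (l2_norm (X *\<^sub>v e \<omega>))\<^sup>2)" using X_int(1) by simp
    fix \<omega> assume \<omega>: "\<omega> \<in> space M"
    have "(l2_norm (err i \<omega>))\<^sup>2 \<le> Pu * (l2_norm (err k \<omega>))\<^sup>2"
      unfolding Pu_def using i step(2)[OF \<omega>] factor_nonneg
      by (intro interval_prod_upper[where N = "\<lambda>j. (l2_norm (err j \<omega>))\<^sup>2"]) auto
    then show "(l2_norm (\<gamma> i - \<gamma>h i \<omega>))\<^sup>2 \<le> Pu * (l2_norm (X *\<^sub>v e \<omega>))\<^sup>2"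
      using norm_err[OF \<omega>] i err_k[OF \<omega>] by simp
  qed
  also have "\<dots> \<le> Pu * (\<sigma>\<^sup>2 * (real (s k) / (1 - ?\<delta>)))"
    unfolding E_k using Pu sum_up by (intro mult_left_mono) auto
  also have "\<dots> = \<sigma>\<^sup>2 * real (s k) * (Pu / (1 - ?\<delta>))" by simp
  finally have upper: "(LINT \<omega>|M. (l2_norm (\<gamma> i - \<gamma>h i \<omega>))\<^sup>2)
    \<le> \<sigma>\<^sup>2 * real (s k) * (Pu / (1 - ?\<delta>))" .

  have lower: "\<sigma>\<^sup>2 * real (s k) * (Pl / (1 + ?\<delta>)) \<le> (LINT \<omega>|M. (l2_norm (\<gamma> i - \<gamma>h i \<omega>))\<^sup>2)"
    if cases: "(\<forall>j\<in>{i+1..k}. 0 \<le> q j - \<delta>' j) \<or> Pl \<le> 0"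
  \<comment> \<open>A nonpositive product makes the claim trivial, as the integrand is a square.
    Otherwise \<open>cases\<close> leaves only nonnegative factors, and the pointwise chain
    applies.\<close>
  proof (cases "Pl \<le> 0")
    case True
    then have "\<sigma>\<^sup>2 * real (s k) * (Pl / (1 + ?\<delta>)) \<le> 0"
      using \<delta> by (intro mult_nonneg_nonpos divide_nonpos_nonneg) auto
    also have "0 \<le> (LINT \<omega>|M. (l2_norm (\<gamma> i - \<gamma>h i \<omega>))\<^sup>2)" by simp
    finally show ?thesis .
  next
    case False
    with cases have nonneg: "\<And>j. i < j \<Longrightarrow> j \<le> k \<Longrightarrow> 0 \<le> q j - \<delta>' j" by auto
    have "\<sigma>\<^sup>2 * real (s k) * (Pl / (1 + ?\<delta>)) = Pl * (\<sigma>\<^sup>2 * (real (s k) / (1 + ?\<delta>)))" by simp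
    also have "\<dots> \<le> expectation (\<lambda>\<omega>. Pl * (l2_norm (X *\<^sub>v e \<omega>))\<^sup>2)"
      unfolding E_k using False sum_lo by (intro mult_left_mono) auto
    also have "\<dots> \<le> (LINT \<omega>|M. (l2_norm (\<gamma> i - \<gamma>h i \<omega>))\<^sup>2)"
    proof (rule integral_mono[OF _ integrable_err])
      show "integrable M (\<lambda>\<omega>. Pl * (l2_norm (X *\<^sub>v e \<omega>))\<^sup>2)" using X_int(1) by simp
      fix \<omega> assume \<omega>: "\<omega> \<in> space M"
      have "Pl * (l2_norm (err k \<omega>))\<^sup>2 \<le> (l2_norm (err i \<omega>))\<^sup>2"
        unfolding Pl_def using i step(1)[OF \<omega>] nonneg
        by (intro interval_prod_lower[where N = "\<lambda>j. (l2_norm (err j \<omega>))\<^sup>2"]) auto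
      then show "Pl * (l2_norm (X *\<^sub>v e \<omega>))\<^sup>2 \<le> (l2_norm (\<gamma> i - \<gamma>h i \<omega>))\<^sup>2"
        using norm_err[OF \<omega>] i err_k[OF \<omega>] by simp
    qed
    finally show ?thesis .
  qed
  show "integrable M (\<lambda>\<omega>. (l2_norm (\<gamma> i - \<gamma>h i \<omega>))\<^sup>2) \<and>
    ((\<forall>j\<in>{i+1..k}. 0 \<le> real (s (j - 1)) / real (m (j - 1)) - subset_rip_const (s (j - 1)) (s j) (D j))
      \<or> (\<Prod>j=i+1..k. real (s (j - 1)) / real (m (j - 1)) - subset_rip_const (s (j - 1)) (s j) (D j)) \<le> 0
      \<longrightarrow>
      \<sigma>\<^sup>2 * real (s k) * ((\<Prod>j=i+1..k. real (s (j - 1)) / real (m (j - 1)) - subset_rip_const (s (j - 1)) (s j) (D j))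
          / (1 + rip_const (s k) (dict_prod D k)))
        \<le> (LINT \<omega>|M. (l2_norm (\<gamma> i - \<gamma>h i \<omega>))\<^sup>2)) \<and>
    (LINT \<omega>|M. (l2_norm (\<gamma> i - \<gamma>h i \<omega>))\<^sup>2)
      \<le> \<sigma>\<^sup>2 * real (s k) * ((\<Prod>j=i+1..k. real (s (j - 1)) / real (m (j - 1)) + subset_rip_const (s (j - 1)) (s j) (D j))
          / (1 - rip_const (s k) (dict_prod D k)))"
    using integrable_err upper lower unfolding Pu_def Pl_def q_def \<delta>'_def by blast
qed

end
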